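(* Let $L$ be a logic above $\mathbf{S4}$. The following conditions are equivalent. (1) $L$ is well-connected. (2) $L$ is the logic of a general frame over the infinite binary tree $\mathfrak{T}_2$. (3) $L=L(\mathfrak{A})$ for some subalgebra $\mathfrak{A}$ of the closure algebra $\mathfrak{T}_2^+$.
   Context: Modal formulas are built from a countably infinite set of propositional letters using the Boolean connectives, $\top,\bot$, and the unary operators $\Diamond,\Box$. A normal modal logic is a set of modal formulas containing all tautologies, all instances of $\Diamond(\varphi\vee\psi)\leftrightarrow(\Diamond\varphi\vee\Diamond\psi)$ and $\Box\varphi\leftrightarrow\neg\Diamond\neg\varphi$, and $\Diamond\bot\leftrightarrow\bot$, and closed under Modus Ponens, Necessitation ($\varphi/\Box\varphi$) and uniform substitution. $\mathbf{S4}$ is the least normal modal logic containing all instances of $\Diamond\Diamond\varphi\to\Diamond\varphi$ and $\varphi\to\Diamond\varphi$. A logic above $\mathbf{S4}$ is a normal modal logic containing $\mathbf{S4}$. A modal algebra is a Boolean algebra $A$ with a unary $\Diamond$ satisfying $\Diamond(a\vee b)=\Diamond a\vee\Diamond b$ and $\Diamond 0=0$; $\Box a=\neg\Diamond\neg a$. It is a closure algebra if $a\le\Diamond a$ and $\Diamond\Diamond a\le\Diamond a$ for all $a$. A formula is valid in a modal algebra if, read as a polynomial, it evaluates to $1$ under every assignment; $L(\mathfrak{A})$ is the set of formulas valid in $\mathfrak{A}$. A closure algebra is well-connected if $\Diamond a\wedge\Diamond b=0$ implies $a=0$ or $b=0$. A logic $L$ above $\mathbf{S4}$ is well-connected if $L=L(\mathfrak{A})$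 for some well-connected closure algebra $\mathfrak{A}$. $\mathfrak{T}_2=(T_2,\le)$, where $T_2$ is the set of finite $\{0,1\}$-valued sequences (including the empty sequence) and $a\le b$ iff $a$ is an initial segment of $b$. For a Kripke frame $\mathfrak{F}=(W,R)$ ($R$ a binary relation on the set $W$), $\mathfrak{F}^+=(\wp(W),R^{-1})$, where $R^{-1}(U)=\{w: wRv\text{ for some }v\in U\}$. A general frame over $\mathfrak{F}=(W,R)$ is a triple $(W,R,\mathcal{P})$ with $\mathcal{P}$ a subalgebra of $\mathfrak{F}^+$; its logic is $L(\mathcal{P})$. *)

theory Defs
  imports "HOL-Library.Sublist" "HOL-Algebra.Congruence"
begin

section \<open>Modal formulas and logics above S4\<close>

datatype fm =
    Var nat
  | Top
  | Bot
  | Neg fm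
  | Con fm fm
  | Dis fm fm
  | Imp fm fm
  | Dia fm
  | Box fm

abbreviation Iff :: "fm \<Rightarrow> fm \<Rightarrow> fm" where
  "Iff \<phi> \<psi> \<equiv> Con (Imp \<phi> \<psi>) (Imp \<psi> \<phi>)"

primrec substitute :: "(nat \<Rightarrow> fm) \<Rightarrow> fm \<Rightarrow> fm" where
  "substitute \<sigma> (Var n) = \<sigma> n"
| "substitute \<sigma> Top = Top"
| "substitute \<sigma> Bot = Bot"
| "substitute \<sigma> (Neg \<phi>) = Neg (substitute \<sigma> \<phi>)"
| "substitute \<sigma> (Con \<phi> \<psi>) = Con (substitute \<sigma> \<phi>) (substitute \<sigma> \<psi>)"
| "substitute \<sigma> (Dis \<phi> \<psi>) = Dis (substitute \<sigma> \<phi>) (substitute \<sigma> \<psi>)"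
| "substitute \<sigma> (Imp \<phi> \<psi>) = Imp (substitute \<sigma> \<phi>) (substitute \<sigma> \<psi>)"
| "substitute \<sigma> (Dia \<phi>) = Dia (substitute \<sigma> \<phi>)"
| "substitute \<sigma> (Box \<phi>) = Box (substitute \<sigma> \<phi>)"

text \<open>Propositional truth: letters and formulas headed by a modal operator are the atoms, so
  that tautologies are the substitution instances of classical propositional tautologies.\<close>

primrec prop_true :: "(fm \<Rightarrow> bool) \<Rightarrow> fm \<Rightarrow> bool" where
  "prop_true v (Var n) = v (Var n)"
| "prop_true v Top = True"
| "prop_true v Bot = False"
| "prop_true v (Neg \<phi>) = (\<not> prop_true v \<phi>)"
| "prop_true v (Con \<phi> \<psi>) = (prop_true v \<phi> \<and> prop_true v \<psi>)"
| "prop_true v (Dis \<phi> \<psi>) = (prop_true v \<phi> \<or> prop_true v \<psi>)"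
| "prop_true v (Imp \<phi> \<psi>) = (prop_true v \<phi> \<longrightarrow> prop_true v \<psi>)"
| "prop_true v (Dia \<phi>) = v (Dia \<phi>)"
| "prop_true v (Box \<phi>) = v (Box \<phi>)"

definition tautology :: "fm \<Rightarrow> bool" where
  "tautology \<phi> \<longleftrightarrow> (\<forall>v. prop_true v \<phi>)"

definition normal_modal_logic :: "fm set \<Rightarrow> bool" where
  "normal_modal_logic L \<longleftrightarrow>
     (\<forall>\<phi>. tautology \<phi> \<longrightarrow> \<phi> \<in> L) \<and>
     (\<forall>\<phi> \<psi>. Iff (Dia (Dis \<phi> \<psi>)) (Dis (Dia \<phi>) (Dia \<psi>)) \<in> L) \<and>
     (\<forall>\<phi>. Iff (Box \<phi>) (Neg (Dia (Neg \<phi>))) \<in> L) \<and>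
     Iff (Dia Bot) Bot \<in> L \<and>
     (\<forall>\<phi> \<psi>. \<phi> \<in> L \<longrightarrow> Imp \<phi> \<psi> \<in> L \<longrightarrow> \<psi> \<in> L) \<and>
     (\<forall>\<phi>. \<phi> \<in> L \<longrightarrow> Box \<phi> \<in> L) \<and>
     (\<forall>\<sigma> \<phi>. \<phi> \<in> L \<longrightarrow> substitute \<sigma> \<phi> \<in> L)"

definition S4 :: "fm set" where
  "S4 = \<Inter> {L. normal_modal_logic L \<and>
             (\<forall>\<phi>. Imp (Dia (Dia \<phi>)) (Dia \<phi>) \<in> L) \<and>
             (\<forall>\<phi>. Imp \<phi> (Dia \<phi>) \<in> L)}"

definition logic_above_S4 :: "fm set \<Rightarrow> bool" where
  "logic_above_S4 L \<longleftrightarrow> normal_modal_logic L \<and> S4 \<subseteq> L"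


section \<open>Modal algebras and closure algebras\<close>

text \<open>Algebras carry an explicit carrier set, since algebras and their subalgebras
  are quantified over.\<close>

record 'a modal_alg = "'a partial_object" +
  meet :: "'a \<Rightarrow> 'a \<Rightarrow> 'a"
  join :: "'a \<Rightarrow> 'a \<Rightarrow> 'a"
  compl :: "'a \<Rightarrow> 'a"
  bottom :: 'a
  one :: 'a
  dia :: "'a \<Rightarrow> 'a"

definition box :: "'a modal_alg \<Rightarrow> 'a \<Rightarrow> 'a" where
  "box A a = compl A (dia A (compl A a))"

definition below :: "'a modal_alg \<Rightarrow> 'a \<Rightarrow> 'a \<Rightarrow> bool" where
  "below A a b \<longleftrightarrow> meet A a b = a"

text \<open>The Boolean axioms are those of \<^locale>\<open>abstract_boolean_algebra\<close> relativised to the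
  carrier, together with nontriviality. Nontriviality is needed: the logic of the one-element
  algebra is the set of all formulas, which is not the logic of any algebra of subsets of a
  nonempty set, although the one-element algebra would vacuously be well-connected.\<close>

locale modal_algebra =
  fixes A :: "'a modal_alg"
  assumes meet_closed: "\<lbrakk>a \<in> carrier A; b \<in> carrier A\<rbrakk> \<Longrightarrow> meet A a b \<in> carrier A"
    and join_closed: "\<lbrakk>a \<in> carrier A; b \<in> carrier A\<rbrakk> \<Longrightarrow> join A a b \<in> carrier A"
    and compl_closed: "a \<in> carrier A \<Longrightarrow> compl A a \<in> carrier A"
    and bottom_closed: "bottom A \<in> carrier A"
    and one_closed: "one A \<in> carrier A"
    and dia_closed: "a \<in> carrier A \<Longrightarrow> dia A a \<in> carrier A"
    and meet_assoc: "\<lbrakk>a \<in> carrier A; b \<in> carrier A; c \<in> carrier A\<rbrakk> \<Longrightarrow>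
          meet A (meet A a b) c = meet A a (meet A b c)"
    and join_assoc: "\<lbrakk>a \<in> carrier A; b \<in> carrier A; c \<in> carrier A\<rbrakk> \<Longrightarrow>
          join A (join A a b) c = join A a (join A b c)"
    and meet_commute: "\<lbrakk>a \<in> carrier A; b \<in> carrier A\<rbrakk> \<Longrightarrow> meet A a b = meet A b a"
    and join_commute: "\<lbrakk>a \<in> carrier A; b \<in> carrier A\<rbrakk> \<Longrightarrow> join A a b = join A b a"
    and meet_join_distrib: "\<lbrakk>a \<in> carrier A; b \<in> carrier A; c \<in> carrier A\<rbrakk> \<Longrightarrow>
          meet A a (join A b c) = join A (meet A a b) (meet A a c)"
    and join_meet_distrib: "\<lbrakk>a \<in> carrier A; b \<in> carrier A; c \<in> carrier A\<rbrakk> \<Longrightarrow>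
          join A a (meet A b c) = meet A (join A a b) (join A a c)"
    and meet_one: "a \<in> carrier A \<Longrightarrow> meet A a (one A) = a"
    and join_bottom: "a \<in> carrier A \<Longrightarrow> join A a (bottom A) = a"
    and meet_compl: "a \<in> carrier A \<Longrightarrow> meet A a (compl A a) = bottom A"
    and join_compl: "a \<in> carrier A \<Longrightarrow> join A a (compl A a) = one A"
    and nontrivial: "bottom A \<noteq> one A"
    and dia_join: "\<lbrakk>a \<in> carrier A; b \<in> carrier A\<rbrakk> \<Longrightarrow>
          dia A (join A a b) = join A (dia A a) (dia A b)"
    and dia_bottom: "dia A (bottom A) = bottom A"

locale closure_algebra = modal_algebra A for A :: "'a modal_alg" +
  assumes dia_increasing: "a \<in> carrier A \<Longrightarrow> below A a (dia A a)"
    and dia_dia: "a \<in> carrier A \<Longrightarrow> below A (dia A (dia A a)) (dia A a)"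

definition well_connected :: "'a modal_alg \<Rightarrow> bool" where
  "well_connected A \<longleftrightarrow>
     (\<forall>a\<in>carrier A. \<forall>b\<in>carrier A.
        meet A (dia A a) (dia A b) = bottom A \<longrightarrow> a = bottom A \<or> b = bottom A)"

text \<open>\<open>subalgebra B A\<close> means that the operations of \<open>B\<close> are those of \<open>A\<close>, and the carrier of
  \<open>B\<close> is a subset of that of \<open>A\<close> closed under them.\<close>

definition closed_subset :: "'a set \<Rightarrow> 'a modal_alg \<Rightarrow> bool" where
  "closed_subset S A \<longleftrightarrow>
     S \<subseteq> carrier A \<and> bottom A \<in> S \<and> one A \<in> S \<and>
     (\<forall>a\<in>S. \<forall>b\<in>S. meet A a b \<in> S \<and> join A a b \<in> S) \<and>
     (\<forall>a\<in>S. compl A a \<in> S \<and> dia A a \<in> S)"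

definition subalgebra :: "'a modal_alg \<Rightarrow> 'a modal_alg \<Rightarrow> bool" where
  "subalgebra B A \<longleftrightarrow> closed_subset (carrier B) A \<and> B = A\<lparr>carrier := carrier B\<rparr>"

primrec eval_fm :: "'a modal_alg \<Rightarrow> (nat \<Rightarrow> 'a) \<Rightarrow> fm \<Rightarrow> 'a" where
  "eval_fm A v (Var n) = v n"
| "eval_fm A v Top = one A"
| "eval_fm A v Bot = bottom A"
| "eval_fm A v (Neg \<phi>) = compl A (eval_fm A v \<phi>)"
| "eval_fm A v (Con \<phi> \<psi>) = meet A (eval_fm A v \<phi>) (eval_fm A v \<psi>)"
| "eval_fm A v (Dis \<phi> \<psi>) = join A (eval_fm A v \<phi>) (eval_fm A v \<psi>)"
| "eval_fm A v (Imp \<phi> \<psi>) = join A (compl A (eval_fm A v \<phi>)) (eval_fm A v \<psi>)"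
| "eval_fm A v (Dia \<phi>) = dia A (eval_fm A v \<phi>)"
| "eval_fm A v (Box \<phi>) = box A (eval_fm A v \<phi>)"

definition valid_in :: "'a modal_alg \<Rightarrow> fm \<Rightarrow> bool" where
  "valid_in A \<phi> \<longleftrightarrow> (\<forall>v. (\<forall>n. v n \<in> carrier A) \<longrightarrow> eval_fm A v \<phi> = one A)"

definition logic_of :: "'a modal_alg \<Rightarrow> fm set" where
  "logic_of A = {\<phi>. valid_in A \<phi>}"

text \<open>HOL cannot quantify over types inside a formula, so the type in which the carriers of
  the algebras live is a parameter. Only its being infinite matters: formulas are countably many,
  so the logic of an algebra is the logic of a countable subalgebra, well-connectedness passes
  to subalgebras, and a countable algebra has a copy with carrier in any infinite type.\<close>

definition well_connected_logic :: "'a itself \<Rightarrow> fm set \<Rightarrow> bool" where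
  "well_connected_logic _ L \<longleftrightarrow>
     (\<exists>A :: 'a modal_alg. closure_algebra A \<and> well_connected A \<and> L = logic_of A)"


section \<open>Kripke frames, general frames and the infinite binary tree\<close>

definition kripke_frame :: "'w set \<Rightarrow> 'w rel \<Rightarrow> bool" where
  "kripke_frame W R \<longleftrightarrow> R \<subseteq> W \<times> W"

definition complex_algebra :: "'w set \<Rightarrow> 'w rel \<Rightarrow> 'w set modal_alg" where
  "complex_algebra W R =
     \<lparr>carrier = Pow W,
      meet = (\<inter>),
      join = (\<union>),
      compl = (\<lambda>U. W - U),
      bottom = {},
      one = W,
      dia = (\<lambda>U. {w \<in> W. \<exists>v\<in>U. (w, v) \<in> R})\<rparr>"

definition general_frame :: "'w set \<Rightarrow> 'w rel \<Rightarrow> 'w set set \<Rightarrow> bool" where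
  "general_frame W R P \<longleftrightarrow>
     kripke_frame W R \<and> subalgebra ((complex_algebra W R)\<lparr>carrier := P\<rparr>) (complex_algebra W R)"

definition general_frame_logic :: "'w set \<Rightarrow> 'w rel \<Rightarrow> 'w set set \<Rightarrow> fm set" where
  "general_frame_logic W R P = logic_of ((complex_algebra W R)\<lparr>carrier := P\<rparr>)"

definition T2 :: "bool list set" where
  "T2 = UNIV"

definition T2_le :: "bool list rel" where
  "T2_le = {(a, b). prefix a b}"

lemma kripke_frame_T2: "kripke_frame T2 T2_le"
  by (simp add: kripke_frame_def T2_def)

lemma modal_algebra_complex_algebra:
  assumes "W \<noteq> {}"
  shows "modal_algebra (complex_algebra W R)"
  using assms by unfold_locales (auto simp: complex_algebra_def)

lemma closure_algebra_T2: "closure_algebra (complex_algebra T2 T2_le)"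
proof -
  interpret modal_algebra "complex_algebra T2 T2_le"
    by (rule modal_algebra_complex_algebra) (simp add: T2_def)
  show ?thesis
    by unfold_locales
      (auto simp: complex_algebra_def below_def T2_def T2_le_def
        intro: prefix_order.order_trans)
qed

lemma subalgebra_modal_algebra:
  assumes "modal_algebra A" "subalgebra B A"
  shows "modal_algebra B"
proof -
  interpret modal_algebra A by fact
  define S where "S = carrier B"
  have B: "B = A\<lparr>carrier := S\<rparr>" and S: "closed_subset S A"
    using assms(2) by (simp_all add: subalgebra_def S_def)
  have sub: "a \<in> carrier A" if "a \<in> S" for a
    using that S by (auto simp: closed_subset_def)
  have eqs: "carrier B = S" "meet B = meet A" "join B = join A" "compl B = compl A"
    "bottom B = bottom A" "one B = one A" "dia B = dia A"
    by (subst B, simp)+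
  show ?thesis
  proof (unfold_locales, unfold eqs)
  qed (assumption
      | (rule meet_assoc join_assoc meet_commute join_commute meet_join_distrib
          join_meet_distrib meet_one join_bottom meet_compl join_compl nontrivial dia_join
          dia_bottom; erule sub)
      | (insert S, simp add: closed_subset_def; fail))+
qed

end

theory Submission
  imports Defs "HOL-Library.Countable_Set"
begin

text \<open>
  Both directions go through countable algebras. There are only countably many formulas, so
  choosing for every formula that fails in an algebra one valuation refuting it, and closing the
  countably many values used under the operations, gives a countable subalgebra with the same
  logic (\<open>ex_countable_subalgebra_same_logic\<close>). The closure algebra axioms and well-connectedness
  pass to subalgebras.

  In \<open>\<TT>\<^sub>2\<^sup>+\<close> every nonempty set has the empty sequence in its closure, so \<open>\<TT>\<^sub>2\<^sup>+\<close> and all its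
  subalgebras are well-connected; a countable subalgebra with the same logic can be copied into
  any infinite type.

  Conversely, a countable well-connected closure algebra \<open>A\<close> embeds in \<open>\<TT>\<^sub>2\<^sup>+\<close>
  (\<open>countable_well_connected_embeds_T2\<close>). Its ultrafilters form a Kripke frame, reflexive and
  transitive by the closure axioms, in which \<open>\<diamond>a \<in> U\<close> says that \<open>U\<close> sees an ultrafilter containing \<open>a\<close>.
  By well-connectedness the elements \<open>\<diamond>a\<close> with \<open>a \<noteq> 0\<close> are downward directed, hence lie in a single
  ultrafilter, which serves as a root. Starting there, label the nodes of the binary
  tree by ultrafilters (\<open>binary_tree_unravelling\<close>): a left child inherits the label of its parent,
  and a right child gets a witness for one of the countably many requests \<open>\<diamond>a \<in> U\<close>. Moving left
  postpones a request without changing the label, so although branching is binary every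
  request is met above every node. Sending \<open>a\<close> to the set of nodes whose label contains \<open>a\<close> is
  then an embedding; it is injective because the root label contains \<open>\<diamond>a\<close> for every \<open>a \<noteq> 0\<close>.
\<close>

section \<open>Subalgebras and isomorphic copies\<close>

instance fm :: countable
  by countable_datatype

lemma (in modal_algebra) eval_fm_closed:
  assumes "\<And>n. v n \<in> carrier A"
  shows "eval_fm A v \<phi> \<in> carrier A"
  using assms
  by (induction \<phi>)
    (auto simp: box_def meet_closed join_closed compl_closed bottom_closed one_closed dia_closed)

lemma eval_fm_carrier_update: "eval_fm (A\<lparr>carrier := S\<rparr>) v \<phi> = eval_fm A v \<phi>"
  by (induction \<phi>) (auto simp: box_def)

lemma subalgebra_carrier_update:
  "closed_subset S A \<Longrightarrow> subalgebra (A\<lparr>carrier := S\<rparr>) A"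
  by (simp add: subalgebra_def)

lemma subalgebra_closure_algebra:
  assumes "closure_algebra A" "subalgebra B A"
  shows "closure_algebra B"
proof -
  interpret closure_algebra A by fact
  have "modal_algebra B"
    using assms(2) by (rule subalgebra_modal_algebra[OF modal_algebra_axioms])
  moreover obtain S where "B = A\<lparr>carrier := S\<rparr>" "S \<subseteq> carrier A"
    using assms(2) by (auto simp: subalgebra_def closed_subset_def)
  ultimately show ?thesis
    using dia_increasing dia_dia
    by (auto simp: closure_algebra_def closure_algebra_axioms_def below_def)
qed

lemma subalgebra_well_connected:
  assumes "well_connected A" "subalgebra B A"
  shows "well_connected B"
proof -
  obtain S where "B = A\<lparr>carrier := S\<rparr>" "S \<subseteq> carrier A"
    using assms(2) by (auto simp: subalgebra_def closed_subset_def)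
  then show ?thesis
    using assms(1) by (auto simp: well_connected_def)
qed

lemma ex_countable_subalgebra_same_logic:
  fixes A :: "'a modal_alg"
  assumes "modal_algebra A"
  shows "\<exists>B. subalgebra B A \<and> countable (carrier B) \<and> logic_of B = logic_of A"
proof -
  interpret modal_algebra A by fact
  have "\<exists>v. (\<forall>n. v n \<in> carrier A) \<and> (\<phi> \<notin> logic_of A \<longrightarrow> eval_fm A v \<phi> \<noteq> one A)" for \<phi>
  proof (cases "\<phi> \<in> logic_of A")
    case True
    then show ?thesis
      using one_closed by (intro exI[of _ "\<lambda>_. one A"]) simp
  qed (auto simp: logic_of_def valid_in_def)
  then obtain v where v: "\<And>\<phi> n. v \<phi> n \<in> carrier A"
    and refutes: "\<And>\<phi>. \<phi> \<notin> logic_of A \<Longrightarrow> eval_fm A (v \<phi>) \<phi> \<noteq> one A"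
    by metis
  \<comment> \<open>A single valuation with all values of the countably many refuting valuations: the values of
    formulas under it are a countable subalgebra containing all of them.\<close>
  define w where "w = (\<lambda>n. v (from_nat (fst (prod_decode n))) (snd (prod_decode n)))"
  define S where "S = range (eval_fm A w)"
  have w: "w n \<in> carrier A" for n
    by (simp add: w_def v)
  have "closed_subset S A"
    unfolding closed_subset_def
  proof (intro conjI ballI)
    show "S \<subseteq> carrier A"
      using w by (auto simp: S_def intro: eval_fm_closed)
    show "bottom A \<in> S" "one A \<in> S"
      unfolding S_def by (rule range_eqI[of _ _ Bot] range_eqI[of _ _ Top]; simp)+
    fix a assume "a \<in> S"
    then obtain \<phi> where a: "a = eval_fm A w \<phi>" by (auto simp: S_def)
    show "compl A a \<in> S" "dia A a \<in> S"
      unfolding S_def a by (rule range_eqI[of _ _ "Neg \<phi>"] range_eqI[of _ _ "Dia \<phi>"]; simp)+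
    fix b assume "b \<in> S"
    then obtain \<psi> where b: "b = eval_fm A w \<psi>" by (auto simp: S_def)
    show "meet A a b \<in> S" "join A a b \<in> S"
      unfolding S_def a b
      by (rule range_eqI[of _ _ "Con \<phi> \<psi>"] range_eqI[of _ _ "Dis \<phi> \<psi>"]; simp)+
  qed
  then have sub: "S \<subseteq> carrier A" "subalgebra (A\<lparr>carrier := S\<rparr>) A"
    by (auto simp: closed_subset_def subalgebra_carrier_update)
  have v_in: "v \<phi> n \<in> S" for \<phi> n
    unfolding S_def by (rule range_eqI[of _ _ "Var (prod_encode (to_nat \<phi>, n))"]) (simp add: w_def)
  have "logic_of (A\<lparr>carrier := S\<rparr>) = logic_of A"
  proof (intro Set.set_eqI iffI)
    fix \<phi> assume "\<phi> \<in> logic_of (A\<lparr>carrier := S\<rparr>)"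
    then have "eval_fm A (v \<phi>) \<phi> = one A"
      using v_in by (auto simp: logic_of_def valid_in_def eval_fm_carrier_update)
    then show "\<phi> \<in> logic_of A"
      using refutes by blast
  next
    fix \<phi> assume "\<phi> \<in> logic_of A"
    then show "\<phi> \<in> logic_of (A\<lparr>carrier := S\<rparr>)"
      using sub by (auto simp: logic_of_def valid_in_def eval_fm_carrier_update)
  qed
  moreover have "countable S" by (simp add: S_def)
  ultimately show ?thesis
    using sub by (intro exI[of _ "A\<lparr>carrier := S\<rparr>"]) simp
qed

definition modal_iso :: "('a \<Rightarrow> 'b) \<Rightarrow> 'a modal_alg \<Rightarrow> 'b modal_alg \<Rightarrow> bool" where
  "modal_iso h A B \<longleftrightarrow>
     bij_betw h (carrier A) (carrier B) \<and>
     h (bottom A) = bottom B \<and> h (one A) = one B \<and>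
     (\<forall>a\<in>carrier A. h (compl A a) = compl B (h a) \<and> h (dia A a) = dia B (h a)) \<and>
     (\<forall>a\<in>carrier A. \<forall>b\<in>carrier A.
        h (meet A a b) = meet B (h a) (h b) \<and> h (join A a b) = join B (h a) (h b))"

lemma modal_iso_logic_of:
  assumes "modal_algebra A" "modal_iso h A B"
  shows "logic_of A = logic_of B"
proof -
  interpret modal_algebra A by fact
  have bij: "bij_betw h (carrier A) (carrier B)"
    using assms(2) by (simp add: modal_iso_def)
  have eval: "eval_fm B (\<lambda>n. h (v n)) \<phi> = h (eval_fm A v \<phi>)" if v: "\<And>n. v n \<in> carrier A" for v \<phi>
    using assms(2) eval_fm_closed[of v, OF v] compl_closed dia_closed
    by (induction \<phi>) (auto simp: modal_iso_def box_def)
  have one: "h a = one B \<longleftrightarrow> a = one A" if "a \<in> carrier A" for a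
    using that assms(2) one_closed bij
    by (metis (no_types, lifting) modal_iso_def bij_betw_def inj_onD)
  show ?thesis
  proof (intro Set.set_eqI iffI)
    fix \<phi> assume \<phi>: "\<phi> \<in> logic_of A"
    have "eval_fm B u \<phi> = one B" if u: "\<And>n. u n \<in> carrier B" for u
    proof -
      define v where "v = (\<lambda>n. inv_into (carrier A) h (u n))"
      have v: "v n \<in> carrier A" and hv: "h (v n) = u n" for n
        using u[of n] bij unfolding v_def
        by (auto simp: bij_betw_def inv_into_into f_inv_into_f)
      then have "eval_fm B u \<phi> = h (eval_fm A v \<phi>)"
        using eval[of v \<phi>] by simp
      then show ?thesis
        using \<phi> v assms(2) by (simp add: logic_of_def valid_in_def modal_iso_def)
    qed
    then show "\<phi> \<in> logic_of B" by (simp add: logic_of_def valid_in_def)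
  next
    fix \<phi> assume \<phi>: "\<phi> \<in> logic_of B"
    have "eval_fm A v \<phi> = one A" if v: "\<And>n. v n \<in> carrier A" for v
    proof -
      have "h (v n) \<in> carrier B" for n
        using v bij by (auto simp: bij_betw_def)
      then have "eval_fm B (\<lambda>n. h (v n)) \<phi> = one B"
        using \<phi> by (simp add: logic_of_def valid_in_def)
      then show ?thesis
        using eval[OF v] one eval_fm_closed[OF v] by simp
    qed
    then show "\<phi> \<in> logic_of A" by (simp add: logic_of_def valid_in_def)
  qed
qed

lemma ex_isomorphic_copy:
  fixes A :: "'a modal_alg" and g :: "'a \<Rightarrow> 'b"
  assumes A: "closure_algebra A" and wc: "well_connected A" and inj: "inj_on g (carrier A)"
  shows "\<exists>B. closure_algebra B \<and> well_connected B \<and> modal_iso g A B"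
proof -
  interpret closure_algebra A by fact
  define k where "k = inv_into (carrier A) g"
  define B where "B = \<lparr>carrier = g ` carrier A,
      meet = (\<lambda>x y. g (meet A (k x) (k y))), join = (\<lambda>x y. g (join A (k x) (k y))),
      compl = (\<lambda>x. g (compl A (k x))), bottom = g (bottom A), one = g (one A),
      dia = (\<lambda>x. g (dia A (k x)))\<rparr>"
  note closed = meet_closed join_closed compl_closed bottom_closed one_closed dia_closed
  have k: "k (g a) = a" if "a \<in> carrier A" for a
    using that inj by (simp add: k_def)
  have g_eq: "g a = g b \<longleftrightarrow> a = b" if "a \<in> carrier A" "b \<in> carrier A" for a b
    using that inj by (auto dest: inj_onD)
  have "closure_algebra B"
    by unfold_locales
      (auto simp: B_def k closed below_def g_eq nontrivial meet_one join_bottom meet_compl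
        join_compl dia_join dia_bottom dia_increasing[unfolded below_def] dia_dia[unfolded below_def]
        intro: meet_assoc join_assoc meet_commute join_commute meet_join_distrib join_meet_distrib)
  moreover have "well_connected B"
    using wc by (auto simp: well_connected_def B_def k closed g_eq)
  moreover have "modal_iso g A B"
    using inj by (simp add: modal_iso_def B_def k closed inj_on_imp_bij_betw)
  ultimately show ?thesis by blast
qed

section \<open>Ultrafilters of modal algebras\<close>

context modal_algebra
begin

abbreviation le :: "'a \<Rightarrow> 'a \<Rightarrow> bool" (infix "\<preceq>" 50) where
  "a \<preceq> b \<equiv> below A a b"

lemmas closed = meet_closed join_closed compl_closed bottom_closed one_closed dia_closed

lemma join_one:
  assumes a: "a \<in> carrier A"
  shows "join A a (one A) = one A"
proof -
  have "join A a (one A) = meet A (join A a (one A)) (join A a (compl A a))"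
    using a by (simp add: closed meet_one join_compl)
  also have "\<dots> = join A a (meet A (one A) (compl A a))"
    using a by (simp add: closed join_meet_distrib)
  also have "meet A (one A) (compl A a) = compl A a"
    using a by (simp add: closed meet_one meet_commute[of "one A"])
  finally show ?thesis using a by (simp add: join_compl)
qed

lemma meet_bottom:
  assumes a: "a \<in> carrier A"
  shows "meet A a (bottom A) = bottom A"
proof -
  have "meet A a (bottom A) = join A (meet A a (bottom A)) (meet A a (compl A a))"
    using a by (simp add: closed join_bottom meet_compl)
  also have "\<dots> = meet A a (join A (bottom A) (compl A a))"
    using a by (simp add: closed meet_join_distrib)
  also have "join A (bottom A) (compl A a) = compl A a"
    using a by (simp add: closed join_bottom join_commute[of "bottom A"])
  finally show ?thesis using a by (simp add: meet_compl)
qed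

lemma meet_idem:
  assumes a: "a \<in> carrier A"
  shows "meet A a a = a"
proof -
  have "meet A a a = join A (meet A a a) (meet A a (compl A a))"
    using a by (simp add: closed join_bottom meet_compl)
  also have "\<dots> = meet A a (join A a (compl A a))"
    using a by (simp add: closed meet_join_distrib)
  finally show ?thesis using a by (simp add: join_compl meet_one)
qed

lemma le_refl: "a \<in> carrier A \<Longrightarrow> a \<preceq> a"
  by (simp add: below_def meet_idem)

lemma le_trans:
  "\<lbrakk>a \<in> carrier A; b \<in> carrier A; c \<in> carrier A; a \<preceq> b; b \<preceq> c\<rbrakk> \<Longrightarrow> a \<preceq> c"
  unfolding below_def by (metis meet_assoc)

lemma meet_le1: "\<lbrakk>a \<in> carrier A; b \<in> carrier A\<rbrakk> \<Longrightarrow> meet A a b \<preceq> a"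
  unfolding below_def by (metis meet_assoc meet_commute meet_idem meet_closed)

lemma meet_le2: "\<lbrakk>a \<in> carrier A; b \<in> carrier A\<rbrakk> \<Longrightarrow> meet A a b \<preceq> b"
  unfolding below_def by (metis meet_assoc meet_idem)

lemma le_meetI:
  "\<lbrakk>a \<in> carrier A; b \<in> carrier A; c \<in> carrier A; c \<preceq> a; c \<preceq> b\<rbrakk> \<Longrightarrow> c \<preceq> meet A a b"
  unfolding below_def by (metis meet_assoc)

lemma meet_mono:
  assumes "a \<in> carrier A" "b \<in> carrier A" "c \<in> carrier A" "d \<in> carrier A"
    and "a \<preceq> b" "c \<preceq> d"
  shows "meet A a c \<preceq> meet A b d"
proof (rule le_meetI)
  show "meet A a c \<preceq> b" "meet A a c \<preceq> d"
    using le_trans[of "meet A a c" a b] le_trans[of "meet A a c" c d] assms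
    by (simp_all add: meet_closed meet_le1 meet_le2)
qed (use assms in \<open>simp_all add: meet_closed\<close>)

lemma le_join1:
  assumes a: "a \<in> carrier A" and b: "b \<in> carrier A"
  shows "a \<preceq> join A a b"
proof -
  have "meet A a (join A a b) = meet A (join A a (bottom A)) (join A a b)"
    using a by (simp add: join_bottom)
  also have "\<dots> = join A a (meet A (bottom A) b)"
    using a b by (simp add: closed join_meet_distrib)
  also have "meet A (bottom A) b = bottom A"
    using b by (simp add: closed meet_bottom meet_commute[of "bottom A"])
  finally show ?thesis using a by (simp add: below_def join_bottom)
qed

lemma le_bottom: "\<lbrakk>a \<in> carrier A; a \<preceq> bottom A\<rbrakk> \<Longrightarrow> a = bottom A"
  by (simp add: below_def meet_bottom)

lemma le_join_eq:
  assumes a: "a \<in> carrier A" and b: "b \<in> carrier A" and le: "a \<preceq> b"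
  shows "join A a b = b"
proof -
  have "join A a b = join A (meet A b (one A)) (meet A b a)"
    using a b le by (simp add: below_def meet_one meet_commute[of b a] join_commute[of a b])
  also have "\<dots> = meet A b (join A (one A) a)"
    using a b by (simp add: closed meet_join_distrib)
  also have "join A (one A) a = one A"
    using a by (simp add: closed join_one join_commute[of "one A"])
  finally show ?thesis using b by (simp add: meet_one)
qed

lemma dia_mono:
  assumes "a \<in> carrier A" "b \<in> carrier A" "a \<preceq> b"
  shows "dia A a \<preceq> dia A b"
proof -
  have "dia A b = join A (dia A a) (dia A b)"
    using assms dia_join[of a b] by (simp add: le_join_eq)
  then show ?thesis
    using le_join1[of "dia A a" "dia A b"] assms by (simp add: closed)
qed

lemma le_compl_iff:
  assumes a: "a \<in> carrier A" and b: "b \<in> carrier A"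
  shows "a \<preceq> compl A b \<longleftrightarrow> meet A a b = bottom A"
proof
  assume "a \<preceq> compl A b"
  then have "meet A a b = meet A (meet A a (compl A b)) b"
    by (simp add: below_def)
  also have "\<dots> = meet A a (meet A (compl A b) b)"
    using a b by (simp add: closed meet_assoc)
  also have "meet A (compl A b) b = bottom A"
    using b by (simp add: closed meet_compl meet_commute[of "compl A b"])
  finally show "meet A a b = bottom A"
    using a by (simp add: meet_bottom)
next
  assume disj: "meet A a b = bottom A"
  have "a = meet A a (join A (compl A b) b)"
    using a b by (simp add: closed meet_one join_compl join_commute[of "compl A b"])
  also have "\<dots> = join A (meet A a (compl A b)) (bottom A)"
    using a b disj by (simp add: closed meet_join_distrib)
  finally show "a \<preceq> compl A b"
    using a b by (simp add: below_def closed join_bottom)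
qed

lemma compl_compl:
  assumes a: "a \<in> carrier A"
  shows "compl A (compl A a) = a"
proof -
  let ?c = "compl A (compl A a)"
  have "a \<preceq> ?c"
    using a by (simp add: closed le_compl_iff meet_compl)
  moreover have "?c = meet A ?c (join A a (compl A a))"
    using a by (simp add: closed meet_one join_compl)
  then have "?c = join A (meet A ?c a) (meet A ?c (compl A a))"
    using a by (simp add: closed meet_join_distrib)
  then have "?c = meet A ?c a"
    using a by (simp add: closed meet_commute[of ?c "compl A a"] meet_compl join_bottom)
  ultimately show ?thesis
    using a by (simp add: below_def closed meet_commute[of ?c a])
qed

lemma compl_antimono:
  assumes a: "a \<in> carrier A" and b: "b \<in> carrier A" and le: "a \<preceq> b"
  shows "compl A b \<preceq> compl A a"
proof -
  have "a \<preceq> compl A (compl A b)"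
    using b le by (simp add: compl_compl)
  then have "meet A a (compl A b) = bottom A"
    using a b by (simp add: le_compl_iff closed)
  then show ?thesis
    using a b by (simp add: le_compl_iff closed meet_commute[of "compl A b" a])
qed

text \<open>A base of a proper filter. The directed sets used below do not come with an upward closure,
  and Zorn's lemma applies to bases just as well.\<close>

definition prefilter :: "'a set \<Rightarrow> bool" where
  "prefilter D \<longleftrightarrow> D \<subseteq> carrier A \<and> D \<noteq> {} \<and> bottom A \<notin> D \<and>
     (\<forall>a\<in>D. \<forall>b\<in>D. \<exists>c\<in>D. c \<preceq> a \<and> c \<preceq> b)"

definition ultrafilter :: "'a set \<Rightarrow> bool" where
  "ultrafilter U \<longleftrightarrow> U \<subseteq> carrier A \<and> bottom A \<notin> U \<and>
     (\<forall>a\<in>U. \<forall>b\<in>U. meet A a b \<in> U) \<and>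
     (\<forall>a\<in>carrier A. a \<in> U \<or> compl A a \<in> U)"

lemma prefilter_Union_chain:
  assumes "\<C> \<noteq> {}" and pre: "\<And>D. D \<in> \<C> \<Longrightarrow> prefilter D"
    and chain: "\<And>D E. D \<in> \<C> \<Longrightarrow> E \<in> \<C> \<Longrightarrow> D \<subseteq> E \<or> E \<subseteq> D"
  shows "prefilter (\<Union>\<C>)"
  unfolding prefilter_def
proof (intro conjI ballI)
  show "\<Union>\<C> \<subseteq> carrier A" "\<Union>\<C> \<noteq> {}" "bottom A \<notin> \<Union>\<C>"
    using assms(1) pre unfolding prefilter_def by blast+
  fix a b assume "a \<in> \<Union>\<C>" "b \<in> \<Union>\<C>"
  then obtain E where "E \<in> \<C>" "a \<in> E" "b \<in> E"
    using chain by blast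
  then show "\<exists>c\<in>\<Union>\<C>. c \<preceq> a \<and> c \<preceq> b"
    using pre[of E] unfolding prefilter_def by blast
qed

text \<open>The new set stays directed because below any of its elements there is one of the form
  \<open>d \<and> a\<close>, and these decrease with \<open>d\<close>.\<close>

lemma prefilter_adjoin:
  assumes D: "prefilter D" and a: "a \<in> carrier A" 
    and nz: "\<And>d. d \<in> D \<Longrightarrow> meet A d a \<noteq> bottom A"
  shows "prefilter (insert a (D \<union> (\<lambda>d. meet A d a) ` D))"
  (is "prefilter ?E")
proof -
  have sub: "D \<subseteq> carrier A" "D \<noteq> {}" "bottom A \<notin> D"
    using D by (auto simp: prefilter_def)
  have E: "?E \<subseteq> carrier A" using sub a by (auto intro: meet_closed)
  obtain d where "d \<in> D" "d \<in> carrier A"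
    using sub by blast
  then have "a \<noteq> bottom A"
    using nz[of d] meet_bottom[of d] by auto
  then have bot: "bottom A \<notin> ?E"
    using sub(3) nz by (simp add: image_iff) metis
  have below_E: "\<exists>d\<in>D. meet A d a \<preceq> x" if x: "x \<in> ?E" for x
  proof -
    consider "x = a" | "x \<in> D" | d where "d \<in> D" "x = meet A d a" using x by blast
    then show ?thesis
      using sub a by cases (auto intro: meet_le1 meet_le2 le_refl meet_closed)
  qed
  have "\<exists>z\<in>?E. z \<preceq> x \<and> z \<preceq> y" if xy: "x \<in> ?E" "y \<in> ?E" for x y
  proof -
    obtain d e where d: "d \<in> D" "meet A d a \<preceq> x" and e: "e \<in> D" "meet A e a \<preceq> y"
      using below_E xy by meson
    obtain c where c: "c \<in> D" "c \<preceq> d" "c \<preceq> e"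
      using D d e unfolding prefilter_def by blast
    have car: "c \<in> carrier A" "d \<in> carrier A" "e \<in> carrier A" "x \<in> carrier A" "y \<in> carrier A"
      using c d e E xy sub by auto
    have "meet A c a \<preceq> meet A d a" "meet A c a \<preceq> meet A e a"
      using c car a by (simp_all add: meet_mono le_refl)
    then have "meet A c a \<preceq> x" "meet A c a \<preceq> y"
      using le_trans[of "meet A c a" "meet A d a" x] le_trans[of "meet A c a" "meet A e a" y]
        car a d e by (simp_all add: meet_closed)
    then show ?thesis using c by blast
  qed
  with E bot show ?thesis
    unfolding prefilter_def by blast
qed

text \<open>An element disjoint from no member could be adjoined, so by maximality it is already there.
  The right-hand side is monotone in \<open>a\<close>, and its failure puts a member below \<open>\<not>a\<close>; this is how
  a maximal prefilter turns out to be an ultrafilter.\<close>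

lemma maximal_prefilter_mem_iff:
  assumes M: "prefilter M" and max: "\<And>E. prefilter E \<Longrightarrow> M \<subseteq> E \<Longrightarrow> E = M"
    and a: "a \<in> carrier A"
  shows "a \<in> M \<longleftrightarrow> (\<forall>d\<in>M. meet A d a \<noteq> bottom A)"
proof
  assume aM: "a \<in> M"
  show "\<forall>d\<in>M. meet A d a \<noteq> bottom A"
  proof
    fix d assume "d \<in> M"
    then obtain c where c: "c \<in> M" "c \<preceq> d" "c \<preceq> a" 
      using aM M unfolding prefilter_def by blast
    have "c \<in> carrier A" "d \<in> carrier A" "c \<noteq> bottom A"
      using c \<open>d \<in> M\<close> M unfolding prefilter_def by auto
    then show "meet A d a \<noteq> bottom A"
      using c a by (metis le_meetI le_bottom)
  qed
next
  assume "\<forall>d\<in>M. meet A d a \<noteq> bottom A"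
  then show "a \<in> M"
    using max[OF prefilter_adjoin[OF M a]] by blast
qed

lemma prefilter_extends_to_ultrafilter:
  assumes "prefilter D"
  shows "\<exists>U. ultrafilter U \<and> D \<subseteq> U"
proof -
  define \<F> where "\<F> = {E. prefilter E \<and> D \<subseteq> E}"
  have "\<exists>M\<in>\<F>. \<forall>E\<in>\<F>. M \<subseteq> E \<longrightarrow> E = M"
  proof (rule subset_Zorn_nonempty)
    show "\<F> \<noteq> {}" using assms by (auto simp: \<F>_def)
    fix \<C> assume ne: "\<C> \<noteq> {}" and chain: "subset.chain \<F> \<C>"
    have pre: "prefilter E \<and> D \<subseteq> E" if "E \<in> \<C>" for E
      using chain that unfolding \<F>_def subset_chain_def by blast
    have "prefilter (\<Union>\<C>)"
    proof (rule prefilter_Union_chain[OF ne])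
      show "E \<subseteq> E' \<or> E' \<subseteq> E" if "E \<in> \<C>" "E' \<in> \<C>" for E E'
        using chain that unfolding subset_chain_def by blast
    qed (simp add: pre)
    moreover have "D \<subseteq> \<Union>\<C>"
      using ne pre by blast
    ultimately show "\<Union>\<C> \<in> \<F>"
      by (simp add: \<F>_def)
  qed
  then obtain M where M_max: "M \<in> \<F>" "\<forall>E\<in>\<F>. M \<subseteq> E \<longrightarrow> E = M" ..
  then have "prefilter M" "D \<subseteq> M"
    by (simp_all add: \<F>_def)
  have max: "E = M" if "prefilter E" "M \<subseteq> E" for E
    using M_max(2) that \<open>D \<subseteq> M\<close> by (simp add: \<F>_def)
  have mem: "a \<in> M \<longleftrightarrow> (\<forall>d\<in>M. meet A d a \<noteq> bottom A)" if "a \<in> carrier A" for a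
    using \<open>prefilter M\<close> max that by (rule maximal_prefilter_mem_iff)
  have M: "M \<subseteq> carrier A" "bottom A \<notin> M" 
    "\<And>a b. a \<in> M \<Longrightarrow> b \<in> M \<Longrightarrow> \<exists>c\<in>M. c \<preceq> a \<and> c \<preceq> b"
    using \<open>prefilter M\<close> unfolding prefilter_def by blast+
  have up: "b \<in> M" if "a \<in> M" "b \<in> carrier A" "a \<preceq> b" for a b
  proof -
    have "meet A d b \<noteq> bottom A" if "d \<in> M" for d
    proof -
      obtain c where c: "c \<in> M" "c \<preceq> d" "c \<preceq> a"
        using M(3)[OF \<open>d \<in> M\<close> \<open>a \<in> M\<close>] by blast
      have car: "a \<in> carrier A" "c \<in> carrier A" "d \<in> carrier A" "c \<noteq> bottom A"
        using M c \<open>a \<in> M\<close> \<open>d \<in> M\<close> by auto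
      then have "c \<preceq> meet A d b"
        using c that le_trans[of c a b] \<open>b \<in> carrier A\<close> \<open>a \<preceq> b\<close> by (simp add: le_meetI)
      then show ?thesis using car le_bottom[of c] by auto
    qed
    then show ?thesis using mem[OF \<open>b \<in> carrier A\<close>] by blast
  qed
  have "ultrafilter M"
    unfolding ultrafilter_def
  proof (intro conjI ballI)
    show "meet A a b \<in> M" if ab: "a \<in> M" "b \<in> M" for a b
    proof -
      obtain c where c: "c \<in> M" "c \<preceq> a" "c \<preceq> b" using M(3)[OF ab] by blast
      have car: "a \<in> carrier A" "b \<in> carrier A" "c \<in> carrier A" using M(1) that c by auto
      then show ?thesis
        using up[OF c(1)] c by (simp add: le_meetI meet_closed)
    qed
    show "a \<in> M \<or> compl A a \<in> M" if a: "a \<in> carrier A" for a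
    proof (cases "a \<in> M")
      case False
      then obtain d where d: "d \<in> M" "meet A d a = bottom A"
        using mem[OF a] by blast
      then have "d \<preceq> compl A a" using a M(1) le_compl_iff by blast
      then show ?thesis using up[OF d(1)] a compl_closed by blast
    qed simp
  qed (use M in auto)
  then show ?thesis using \<open>D \<subseteq> M\<close> by blast
qed

context
  fixes U assumes U: "ultrafilter U"
begin

lemma ultrafilter_carrier: "a \<in> U \<Longrightarrow> a \<in> carrier A"
  and ultrafilter_bottom: "bottom A \<notin> U"
  using U by (auto simp: ultrafilter_def)

lemma ultrafilter_compl: "a \<in> carrier A \<Longrightarrow> compl A a \<in> U \<longleftrightarrow> a \<notin> U"
  using U unfolding ultrafilter_def by (metis meet_compl)

lemma ultrafilter_up:
  assumes "a \<in> U" "b \<in> carrier A" "a \<preceq> b" 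
  shows "b \<in> U"
proof (rule ccontr)
  assume "b \<notin> U"
  then have "meet A a (compl A b) \<in> U"
    using U assms unfolding ultrafilter_def by blast
  moreover have "a \<preceq> compl A (compl A b)"
    using assms by (simp add: compl_compl)
  then have "meet A a (compl A b) = bottom A"
    using le_compl_iff assms ultrafilter_carrier compl_closed by blast
  ultimately show False using ultrafilter_bottom by simp
qed

lemma ultrafilter_one: "one A \<in> U"
proof (rule ccontr)
  assume "one A \<notin> U"
  then have "compl A (one A) \<in> U" using ultrafilter_compl one_closed by blast
  then show False
    using \<open>one A \<notin> U\<close> ultrafilter_up[of "compl A (one A)" "one A"]
    by (simp add: below_def meet_one closed)
qed

lemma ultrafilter_meet:
  assumes "a \<in> carrier A" "b \<in> carrier A"
  shows "meet A a b \<in> U \<longleftrightarrow> a \<in> U \<and> b \<in> U"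
proof (intro iffI conjI)
  show "a \<in> U" if "meet A a b \<in> U"
    using ultrafilter_up[OF that] assms meet_le1 by simp
  show "b \<in> U" if "meet A a b \<in> U"
    using ultrafilter_up[OF that] assms meet_le2 by simp
  show "meet A a b \<in> U" if "a \<in> U \<and> b \<in> U"
    using U that by (simp add: ultrafilter_def)
qed

lemma ultrafilter_join:
  assumes "a \<in> carrier A" "b \<in> carrier A"
  shows "join A a b \<in> U \<longleftrightarrow> a \<in> U \<or> b \<in> U"
proof
  assume join: "join A a b \<in> U"
  have "meet A (compl A a) (join A a b) = join A (meet A (compl A a) b) (bottom A)"
    using assms by (simp add: closed meet_join_distrib meet_compl
        meet_commute[of "compl A a" a] join_commute[of "bottom A"])
  then have "meet A (compl A a) (join A a b) = meet A (compl A a) b"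
    using assms by (simp add: closed join_bottom)
  then show "a \<in> U \<or> b \<in> U"
    using assms join ultrafilter_meet[of "compl A a" "join A a b"]
      ultrafilter_meet[of "compl A a" b] ultrafilter_compl[of a] by (auto simp: closed)
next
  assume "a \<in> U \<or> b \<in> U"
  then show "join A a b \<in> U"
    using assms ultrafilter_up[of a "join A a b"] ultrafilter_up[of b "join A a b"]
      le_join1[of a b] le_join1[of b a] by (auto simp: join_closed join_commute[of b a])
qed

end

text \<open>The accessibility relation of the Stone dual of \<open>A\<close>.\<close>

definition dual_rel :: "'a set \<Rightarrow> 'a set \<Rightarrow> bool" where
  "dual_rel U V \<longleftrightarrow> (\<forall>a\<in>V. dia A a \<in> U)"

text \<open>The required ultrafilter must contain \<open>a\<close> and avoid every \<open>c\<close> with \<open>\<diamond>c \<notin> U\<close>. These \<open>c\<close> are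
  closed under joins, so the elements \<open>a \<and> \<not>c\<close> are downward directed; none is \<open>0\<close>, since
  \<open>a \<le> c\<close> would give \<open>\<diamond>c \<in> U\<close>.\<close>

lemma ultrafilter_dia_witness:
  assumes U: "ultrafilter U" and a: "a \<in> carrier A" and dia: "dia A a \<in> U"
  shows "\<exists>V. ultrafilter V \<and> dual_rel U V \<and> a \<in> V"
proof -
  define D where "D = {meet A a (compl A c) | c. c \<in> carrier A \<and> dia A c \<notin> U}"
  have in_D: "meet A a (compl A c) \<in> D" if "c \<in> carrier A" "dia A c \<notin> U" for c
    using that unfolding D_def by blast
  have "dia A (bottom A) \<notin> U"
    using ultrafilter_bottom[OF U] by (simp add: dia_bottom)
  then have bot: "bottom A \<in> carrier A" "dia A (bottom A) \<notin> U"
    using bottom_closed by auto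
  have "prefilter D"
    unfolding prefilter_def
  proof (intro conjI ballI)
    show "D \<subseteq> carrier A" using a by (auto simp: D_def closed)
    show "D \<noteq> {}" using in_D[OF bot] by blast
    show "bottom A \<notin> D"
    proof
      assume "bottom A \<in> D"
      then obtain c where c: "c \<in> carrier A" "dia A c \<notin> U" "meet A a (compl A c) = bottom A"
        unfolding D_def by force
      then have "a \<preceq> c"
        using a le_compl_iff[of a "compl A c"] by (simp add: compl_closed compl_compl)
      then have "dia A a \<preceq> dia A c" using a c dia_mono by blast
      then show False using c dia ultrafilter_up[OF U] dia_closed by blast
    qed
    fix x y assume "x \<in> D" "y \<in> D"
    then obtain c d where c: "c \<in> carrier A" "dia A c \<notin> U" "x = meet A a (compl A c)"
      and d: "d \<in> carrier A" "dia A d \<notin> U" "y = meet A a (compl A d)"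
      unfolding D_def by blast
    let ?z = "meet A a (compl A (join A c d))"
    have "dia A (join A c d) \<notin> U"
      using c d ultrafilter_join[OF U] by (simp add: dia_join dia_closed)
    then have "?z \<in> D" using in_D c d join_closed by blast
    moreover have "?z \<preceq> meet A a (compl A e)" if "e \<in> carrier A" "e \<preceq> join A c d" for e
      using a c d that by (simp add: meet_mono closed le_refl compl_antimono)
    then have "?z \<preceq> x" "?z \<preceq> y"
      using c d le_join1[of c d] le_join1[of d c] join_commute[of c d] by simp_all
    ultimately show "\<exists>z\<in>D. z \<preceq> x \<and> z \<preceq> y" by blast
  qed
  then obtain V where V: "ultrafilter V" "D \<subseteq> V"
    using prefilter_extends_to_ultrafilter by blast
  have "a \<in> V \<and> compl A c \<in> V" if "c \<in> carrier A" "dia A c \<notin> U" for c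
    using in_D[OF that] V ultrafilter_meet[OF V(1) a] that(1) by (auto simp: closed)
  then have "a \<in> V" and "\<And>c. c \<in> carrier A \<Longrightarrow> dia A c \<notin> U \<Longrightarrow> c \<notin> V"
    using bot ultrafilter_compl[OF V(1)] by blast+
  then have "dual_rel U V"
    unfolding dual_rel_def using ultrafilter_carrier[OF V(1)] by blast
  then show ?thesis using V \<open>a \<in> V\<close> by blast
qed

end

context closure_algebra
begin

lemma dual_rel_refl: "ultrafilter U \<Longrightarrow> dual_rel U U"
  unfolding dual_rel_def
  using ultrafilter_up[of U _ "dia A _"] ultrafilter_carrier[of U] by (simp add: dia_closed dia_increasing)

lemma dual_rel_trans:
  assumes "ultrafilter U" "ultrafilter V" "ultrafilter W" "dual_rel U V" "dual_rel V W"
  shows "dual_rel U W"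
  unfolding dual_rel_def
proof
  fix a assume "a \<in> W"
  then have "dia A (dia A a) \<in> U" "a \<in> carrier A"
    using assms by (auto simp: dual_rel_def ultrafilter_carrier)
  then show "dia A a \<in> U"
    using ultrafilter_up[OF assms(1)] by (simp add: dia_closed dia_dia)
qed

text \<open>Well-connectedness makes \<open>c = \<diamond>a \<and> \<diamond>b\<close> nonzero for nonzero \<open>a\<close> and \<open>b\<close>; the closure axioms
  put \<open>\<diamond>c\<close> below both \<open>\<diamond>a\<close> and \<open>\<diamond>b\<close>, so the closures of nonzero elements are downward directed.\<close>

lemma well_connected_root:
  assumes wc: "well_connected A"
  shows "\<exists>U. ultrafilter U \<and> (\<forall>a\<in>carrier A. a \<noteq> bottom A \<longrightarrow> dia A a \<in> U)"
proof -
  define D where "D = {dia A a | a. a \<in> carrier A \<and> a \<noteq> bottom A}"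
  have "prefilter D"
    unfolding prefilter_def
  proof (intro conjI ballI)
    show "D \<subseteq> carrier A" by (auto simp: D_def dia_closed)
    show "D \<noteq> {}" using nontrivial one_closed by (auto simp: D_def)
    show "bottom A \<notin> D"
      unfolding D_def using dia_increasing le_bottom by force
    fix x y assume "x \<in> D" "y \<in> D"
    then obtain a b where a: "a \<in> carrier A" "a \<noteq> bottom A" "x = dia A a"
      and b: "b \<in> carrier A" "b \<noteq> bottom A" "y = dia A b"
      unfolding D_def by blast
    let ?c = "meet A x y"
    have car: "x \<in> carrier A" "y \<in> carrier A" "?c \<in> carrier A"
      using a b by (auto simp: closed)
    have "?c \<noteq> bottom A"
      using wc a b unfolding well_connected_def by blast
    then have "dia A ?c \<in> D" using car unfolding D_def by blast
    moreover have "dia A ?c \<preceq> dia A x" "dia A ?c \<preceq> dia A y"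
      using car by (simp_all add: dia_mono meet_le1 meet_le2)
    then have "dia A ?c \<preceq> x" "dia A ?c \<preceq> y"
      using a b car dia_dia le_trans[of "dia A ?c" "dia A x" x] le_trans[of "dia A ?c" "dia A y" y]
      by (simp_all add: dia_closed)
    ultimately show "\<exists>z\<in>D. z \<preceq> x \<and> z \<preceq> y" by blast
  qed
  then obtain U where "ultrafilter U" "D \<subseteq> U"
    using prefilter_extends_to_ultrafilter by blast
  then show ?thesis
    by (auto simp: D_def)
qed

end

section \<open>Unravelling into the binary tree\<close>

text \<open>A reflexive and transitive relation with countably many kinds of requests unravels into the
  binary tree. At a node of depth \<open>k\<close> the right child deals with the \<open>k\<close>-th request of an enumeration
  in which every request recurs infinitely often. The request at a node is thus met by going
  left, where the label does not change, until its number comes up, and then right.\<close>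

lemma binary_tree_unravelling:
  fixes R :: "'x \<Rightarrow> 'x \<Rightarrow> bool" and requests :: "'x \<Rightarrow> 'q \<Rightarrow> bool"
  assumes root: "r \<in> X"
    and refl: "\<And>x. x \<in> X \<Longrightarrow> R x x"
    and trans: "\<And>x y z. \<lbrakk>x \<in> X; y \<in> X; z \<in> X; R x y; R y z\<rbrakk> \<Longrightarrow> R x z"
    and Q: "countable Q"
    and witness: "\<And>x q. \<lbrakk>x \<in> X; q \<in> Q; requests x q\<rbrakk> \<Longrightarrow> \<exists>y\<in>X. R x y \<and> meets y q"
  shows "\<exists>f :: bool list \<Rightarrow> 'x. f [] = r \<and> range f \<subseteq> X \<and>
    (\<forall>s t. prefix s t \<longrightarrow> R (f s) (f t)) \<and>
    (\<forall>s. \<forall>q\<in>Q. requests (f s) q \<longrightarrow> (\<exists>t. prefix s t \<and> meets (f t) q))"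
proof -
  define e where "e = (\<lambda>k. from_nat_into Q (fst (prod_decode k)))"
  have recurs: "\<exists>k\<ge>m. e k = q" if "q \<in> Q" for q m
  proof -
    have "e (prod_encode (to_nat_on Q q, m)) = q"
      using that Q by (simp add: e_def)
    then show ?thesis using le_prod_encode_2 by blast
  qed
  define step where "step = (\<lambda>k x. if e k \<in> Q \<and> requests x (e k)
      then SOME y. y \<in> X \<and> R x y \<and> meets y (e k) else x)"
  have some: "step k x \<in> X \<and> R x (step k x) \<and> meets (step k x) (e k)"
    if "x \<in> X" "e k \<in> Q" "requests x (e k)" for k x
  proof -
    have "\<exists>y. y \<in> X \<and> R x y \<and> meets y (e k)" using witness that by blast
    from someI_ex[OF this] show ?thesis using that by (simp add: step_def)
  qed
  then have step: "step k x \<in> X \<and> R x (step k x)" if "x \<in> X" for k x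
    using that refl by (cases "e k \<in> Q \<and> requests x (e k)") (auto simp: step_def)
  \<comment> \<open>The recursion runs over the reversed sequence, so that its head is the last branching.\<close>
  define g where "g = rec_list r (\<lambda>b s x. if b then step (length s) x else x)"
  define f where "f = (\<lambda>s. g (rev s))"
  have f_Nil: "f [] = r" and f_snoc: "f (s @ [b]) = (if b then step (length s) (f s) else f s)" for s b
    by (simp_all add: f_def g_def)
  have f_X: "f s \<in> X" for s
    by (induction s rule: rev_induct) (simp_all add: f_Nil f_snoc root step)
  have mono: "R (f s) (f (s @ u))" for s u
  proof (induction u rule: rev_induct)
    case (snoc b u)
    have "R (f (s @ u)) (f ((s @ u) @ [b]))"
      using f_snoc[of "s @ u" b] step[OF f_X] refl[OF f_X] by simp
    then show ?case
      using snoc trans[OF f_X f_X f_X] by (metis append_assoc)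
  qed (simp add: refl f_X)
  have wait: "f (s @ replicate n False) = f s" for s n
  proof (induction n)
    case (Suc n)
    then show ?case
      using f_snoc[of "s @ replicate n False" False] by (simp add: replicate_append_same flip: replicate_Suc)
  qed simp
  have "\<exists>t. prefix s t \<and> meets (f t) q" if "q \<in> Q" "requests (f s) q" for s q
  proof -
    obtain k where k: "length s \<le> k" "e k = q" using recurs \<open>q \<in> Q\<close> by blast
    let ?s = "s @ replicate (k - length s) False"
    have "f (?s @ [True]) = step k (f s)"
      using f_snoc[of ?s True] k by (simp add: wait)
    then have "meets (f (?s @ [True])) q"
      using some[OF f_X, of k s] k that by simp
    then show ?thesis by (intro exI[of _ "?s @ [True]"]) simp
  qed
  then show ?thesis
    using f_Nil f_X mono by (intro exI[of _ f]) (auto simp: prefix_def)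
qed

section \<open>Well-connected logics and the binary tree\<close>

lemma well_connected_T2: "well_connected (complex_algebra T2 T2_le)"
  unfolding well_connected_def
proof (intro ballI impI)
  let ?T = "complex_algebra T2 T2_le"
  fix a b assume meet: "meet ?T (dia ?T a) (dia ?T b) = bottom ?T"
  have "[] \<in> dia ?T c" if "c \<noteq> {}" for c
    using that by (auto simp: complex_algebra_def T2_def T2_le_def)
  moreover have "dia ?T a \<inter> dia ?T b = {}" "bottom ?T = {}"
    using meet by (simp_all add: complex_algebra_def)
  ultimately show "a = bottom ?T \<or> b = bottom ?T"
    by (metis disjoint_iff)
qed

text \<open>The requests to be met in the tree are the elements of \<open>A\<close> themselves: \<open>U\<close> requests \<open>a\<close> if
  \<open>\<diamond>a \<in> U\<close>, and \<open>V\<close> meets the request if \<open>a \<in> V\<close>. Monotonicity of the labelling and the meeting of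
  requests are the two inclusions of preservation of \<open>\<diamond>\<close>.\<close>

lemma countable_well_connected_embeds_T2:
  fixes A :: "'a modal_alg"
  assumes A: "closure_algebra A" and wc: "well_connected A" and count: "countable (carrier A)"
  shows "\<exists>B h. subalgebra B (complex_algebra T2 T2_le) \<and> modal_iso h A B"
proof -
  interpret closure_algebra A by fact
  let ?T = "complex_algebra T2 T2_le"
  obtain r where r: "ultrafilter r" "\<And>a. a \<in> carrier A \<Longrightarrow> a \<noteq> bottom A \<Longrightarrow> dia A a \<in> r"
    using well_connected_root[OF wc] by blast
  have "\<exists>f :: bool list \<Rightarrow> 'a set. f [] = r \<and> range f \<subseteq> {U. ultrafilter U} \<and>
    (\<forall>s t. prefix s t \<longrightarrow> dual_rel (f s) (f t)) \<and>
    (\<forall>s. \<forall>a\<in>carrier A. dia A a \<in> f s \<longrightarrow> (\<exists>t. prefix s t \<and> a \<in> f t))"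
  proof (rule binary_tree_unravelling[where requests = "\<lambda>U a. dia A a \<in> U" and meets = "\<lambda>U a. a \<in> U"])
    show "dual_rel U W" if "U \<in> {U. ultrafilter U}" "V \<in> {U. ultrafilter U}"
      "W \<in> {U. ultrafilter U}" "dual_rel U V" "dual_rel V W" for U V W
      using that dual_rel_trans[of U V W] by simp
    show "\<exists>V\<in>{U. ultrafilter U}. dual_rel U V \<and> a \<in> V"
      if "U \<in> {U. ultrafilter U}" "a \<in> carrier A" "dia A a \<in> U" for U a
      using that ultrafilter_dia_witness[of U a] by auto
  qed (simp_all add: r count dual_rel_refl)
  then obtain f :: "bool list \<Rightarrow> 'a set" where f_root: "f [] = r" and f: "\<And>s. ultrafilter (f s)"
    and forth: "\<And>s t. prefix s t \<Longrightarrow> dual_rel (f s) (f t)"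
    and realised: "\<And>s a. \<lbrakk>a \<in> carrier A; dia A a \<in> f s\<rbrakk> \<Longrightarrow> \<exists>t. prefix s t \<and> a \<in> f t"
    by (elim exE conjE) (simp add: image_subset_iff)
  define h where "h = (\<lambda>a. {s. a \<in> f s})"
  have h_dia: "h (dia A a) = dia ?T (h a)" if "a \<in> carrier A" for a
  proof -
    have "dia A a \<in> f s \<longleftrightarrow> (\<exists>t. a \<in> f t \<and> prefix s t)" for s
      using realised[OF that, of s] forth[of s] unfolding dual_rel_def by meson
    then show ?thesis
      by (simp add: h_def complex_algebra_def T2_def T2_le_def Bex_def)
  qed
  have hom: "h (bottom A) = bottom ?T" "h (one A) = one ?T"
    "\<And>a. a \<in> carrier A \<Longrightarrow> h (compl A a) = compl ?T (h a)"
    "\<And>a b. a \<in> carrier A \<Longrightarrow> b \<in> carrier A \<Longrightarrow> h (meet A a b) = meet ?T (h a) (h b)"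
    "\<And>a b. a \<in> carrier A \<Longrightarrow> b \<in> carrier A \<Longrightarrow> h (join A a b) = join ?T (h a) (h b)"
    by (auto simp: h_def complex_algebra_def T2_def ultrafilter_bottom[OF f] ultrafilter_one[OF f]
        ultrafilter_compl[OF f] ultrafilter_meet[OF f] ultrafilter_join[OF f])
  have nonempty: "h a \<noteq> {}" if "a \<in> carrier A" "a \<noteq> bottom A" for a
    using realised[of a "[]"] r(2)[of a] that by (auto simp: h_def f_root)
  have le: "a \<preceq> b" if "a \<in> carrier A" "b \<in> carrier A" "h a \<subseteq> h b" for a b
  proof -
    \<comment> \<open>Injectivity reduces to \<open>h\<close> having trivial kernel, as in any Boolean algebra.\<close>
    have "h (meet A a (compl A b)) = {}"
      using that hom by (auto simp: closed complex_algebra_def)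
    then have "meet A a (compl A b) = bottom A"
      using nonempty[of "meet A a (compl A b)"] that by (auto simp: closed)
    then show ?thesis
      using that le_compl_iff[of a "compl A b"] by (simp add: closed compl_compl)
  qed
  have inj: "inj_on h (carrier A)"
    by (rule inj_onI) (metis le below_def meet_commute subset_refl)
  define B where "B = ?T\<lparr>carrier := h ` carrier A\<rparr>"
  have "closed_subset (h ` carrier A) ?T"
    unfolding closed_subset_def
  proof (intro conjI ballI)
    show "h ` carrier A \<subseteq> carrier ?T" by (auto simp: complex_algebra_def T2_def)
    show "bottom ?T \<in> h ` carrier A" "one ?T \<in> h ` carrier A"
      by (simp_all add: closed imageI flip: hom)
    fix x assume "x \<in> h ` carrier A"
    then obtain a where a: "a \<in> carrier A" "x = h a" by blast
    then show "compl ?T x \<in> h ` carrier A" "dia ?T x \<in> h ` carrier A"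
      by (simp_all add: closed imageI flip: hom h_dia)
    fix y assume "y \<in> h ` carrier A"
    then obtain b where "b \<in> carrier A" "y = h b" by blast
    then show "meet ?T x y \<in> h ` carrier A" "join ?T x y \<in> h ` carrier A"
      using a by (simp_all add: closed imageI flip: hom)
  qed
  then have "subalgebra B ?T"
    unfolding B_def by (rule subalgebra_carrier_update)
  moreover have "modal_iso h A B"
    using inj hom h_dia by (simp add: modal_iso_def B_def inj_on_imp_bij_betw)
  ultimately show ?thesis by blast
qed

theorem theorem5p9:
  fixes L :: "fm set"
  assumes "infinite (UNIV :: 'a set)"
    and "logic_above_S4 L"
  shows "(well_connected_logic TYPE('a) L \<longleftrightarrow>
            (\<exists>P. general_frame T2 T2_le P \<and> L = general_frame_logic T2 T2_le P)) \<and>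
         ((\<exists>P. general_frame T2 T2_le P \<and> L = general_frame_logic T2 T2_le P) \<longleftrightarrow>
            (\<exists>A. subalgebra A (complex_algebra T2 T2_le) \<and> L = logic_of A))"
proof -
  let ?T = "complex_algebra T2 T2_le"
  \<comment> \<open>A subalgebra is determined by its carrier, so the last two conditions say the same.\<close>
  have frames: "(\<exists>P. general_frame T2 T2_le P \<and> L = general_frame_logic T2 T2_le P) \<longleftrightarrow>
      (\<exists>A. subalgebra A ?T \<and> L = logic_of A)"
    unfolding general_frame_def general_frame_logic_def
    by (metis kripke_frame_T2 subalgebra_def)
  have "\<exists>B. subalgebra B ?T \<and> L = logic_of B" if wcL: "well_connected_logic TYPE('a) L"
  proof -
    obtain A :: "'a modal_alg" where A: "closure_algebra A" "well_connected A" "L = logic_of A"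
      using wcL by (auto simp: well_connected_logic_def)
    interpret A: closure_algebra A by fact
    obtain C where C: "subalgebra C A" "countable (carrier C)" "logic_of C = logic_of A"
      using ex_countable_subalgebra_same_logic[OF A.modal_algebra_axioms] by blast
    interpret C: closure_algebra C
      using A C subalgebra_closure_algebra by blast
    obtain B h where "subalgebra B ?T" "modal_iso h C B"
      using countable_well_connected_embeds_T2[OF C.closure_algebra_axioms] A C
        subalgebra_well_connected by blast
    then show ?thesis
      using modal_iso_logic_of[OF C.modal_algebra_axioms] A C by metis
  qed
  moreover have "well_connected_logic TYPE('a) L" if B: "subalgebra B ?T" "L = logic_of B" for B
  proof -
    interpret B: closure_algebra B
      using subalgebra_closure_algebra[OF closure_algebra_T2 B(1)] .
    obtain C where C: "subalgebra C B" "countable (carrier C)" "logic_of C = logic_of B"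
      using ex_countable_subalgebra_same_logic[OF B.modal_algebra_axioms] by blast
    interpret C: closure_algebra C
      using subalgebra_closure_algebra[OF B.closure_algebra_axioms C(1)] .
    have wc: "well_connected C"
      using well_connected_T2 B C subalgebra_well_connected by blast
    obtain i :: "nat \<Rightarrow> 'a" where "inj i"
      using infinite_countable_subset[OF assms(1)] by blast
    then have "inj_on (i \<circ> to_nat_on (carrier C)) (carrier C)"
      using inj_on_to_nat_on[OF C(2)] by (meson comp_inj_on inj_on_subset subset_UNIV)
    from ex_isomorphic_copy[OF C.closure_algebra_axioms wc this]
    obtain D :: "'a modal_alg" where D: "closure_algebra D" "well_connected D"
      and iso: "modal_iso (i \<circ> to_nat_on (carrier C)) C D"
      by (elim exE conjE)
    have "logic_of C = logic_of D"
      using C.modal_algebra_axioms iso by (rule modal_iso_logic_of)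
    then have "L = logic_of D"
      using B C by simp
    then show ?thesis
      using D unfolding well_connected_logic_def by blast
  qed
  ultimately show ?thesis
    using frames by blast
qed

end
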